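(* Let $n \ge 5$ and let $G$ be the symmetric group $S_n$ or the alternating group $A_n$ in its natural action on $\mathcal{P}=\{1,2,\dots,n\}$. Then there are exactly $n-4$ non-trivial $2$-$(v,k,\lambda)$ designs with point set $\mathcal{P}$ on which $G$ acts as a flag-transitive, point-primitive automorphism group, and all of them are full designs. Their parameters $(v,b,r,k,\lambda)$ are $$\left(n,\ \binom{n}{k},\ \binom{n-1}{k-1},\ k,\ \binom{n-2}{k-2}\right),\qquad k\in\{3,4,\dots,n-2\},$$ where $\binom{n}{k}=\frac{n(n-1)\cdots(n-k+1)}{k(k-1)\cdots 1}$.
   Context: A $2$-$(v,k,\lambda)$ design $\mathcal{D}=(\mathcal{P},\mathcal{B})$ consists of a set $\mathcal{P}$ of $v$ points and a family $\mathcal{B}$ of $b$ distinct $k$-subsets (blocks) of $\mathcal{P}$ such that every two distinct points lie in exactly $\lambda$ blocks; then every point lies in exactly $r$ blocks, with $vr=bk$ and $\lambda(v-1)=r(k-1)$. The design is non-trivial if $2<k<v-1$. It is a full design if $\mathcal{B}$ consists of all $k$-subsets of $\mathcal{P}$. An automorphism is a permutation of $\mathcal{P}$ mapping blocks to blocks. A flag is a pair $(\alpha,B)$ with $\alpha\in B\in\mathcal{B}$; a group $G$ of automorphisms is flag-transitive if it is transitive on flags, and point-primitive if it acts primitively on $\mathcal{P}$. *)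

theory Defs
  imports "HOL-Algebra.Sym_Groups" "HOL-Algebra.Group_Action"
begin

text \<open>
  A design is given by its point set \<open>P\<close> and its set of blocks \<open>\<B>\<close>. The clause
  \<open>lam > 0\<close> is the usual convention that the parameters are positive; it excludes
  the empty family of blocks, which would otherwise be a design with \<open>lam = 0\<close> for every \<open>k\<close>.
\<close>

definition two_design :: "'a set \<Rightarrow> 'a set set \<Rightarrow> nat \<Rightarrow> nat \<Rightarrow> nat \<Rightarrow> bool" where
  "two_design P \<B> v k lam \<longleftrightarrow>
     finite P \<and> card P = v \<and>
     (\<forall>B\<in>\<B>. B \<subseteq> P \<and> card B = k) \<and>
     (\<forall>x\<in>P. \<forall>y\<in>P. x \<noteq> y \<longrightarrow> card {B \<in> \<B>. x \<in> B \<and> y \<in> B} = lam) \<and>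
     lam > 0"

definition nontrivial_two_design :: "'a set \<Rightarrow> 'a set set \<Rightarrow> nat \<Rightarrow> nat \<Rightarrow> nat \<Rightarrow> bool" where
  "nontrivial_two_design P \<B> v k lam \<longleftrightarrow> two_design P \<B> v k lam \<and> 2 < k \<and> k < v - 1"

definition has_parameters ::
  "'a set \<Rightarrow> 'a set set \<Rightarrow> nat \<times> nat \<times> nat \<times> nat \<times> nat \<Rightarrow> bool" where
  "has_parameters P \<B> = (\<lambda>(v, b, r, k, lam).
     two_design P \<B> v k lam \<and> card \<B> = b \<and> (\<forall>x\<in>P. card {B \<in> \<B>. x \<in> B} = r))"

definition full_design :: "'a set \<Rightarrow> 'a set set \<Rightarrow> nat \<Rightarrow> bool" where
  "full_design P \<B> k \<longleftrightarrow> \<B> = {B. B \<subseteq> P \<and> card B = k}"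

definition design_automorphism :: "'a set \<Rightarrow> 'a set set \<Rightarrow> ('a \<Rightarrow> 'a) \<Rightarrow> bool" where
  "design_automorphism P \<B> f \<longleftrightarrow> f \<in> Bij P \<and> (\<forall>B\<in>\<B>. f ` B \<in> \<B>)"

definition acts_as_automorphism_group ::
  "('g, 'm) monoid_scheme \<Rightarrow> 'a set \<Rightarrow> ('g \<Rightarrow> 'a \<Rightarrow> 'a) \<Rightarrow> 'a set set \<Rightarrow> bool" where
  "acts_as_automorphism_group G P \<phi> \<B> \<longleftrightarrow>
     faithful_action G P \<phi> \<and> (\<forall>g\<in>carrier G. design_automorphism P \<B> (\<phi> g))"

definition flags :: "'a set set \<Rightarrow> ('a \<times> 'a set) set" where
  "flags \<B> = {(x, B). x \<in> B \<and> B \<in> \<B>}"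

text \<open>
  \<^const>\<open>group_action\<close> requires each group element to act by an extensional function,
  hence the restrictions in the next definition and in \<open>natural_action\<close>.
\<close>

definition flag_action ::
  "('g \<Rightarrow> 'a \<Rightarrow> 'a) \<Rightarrow> 'a set set \<Rightarrow> 'g \<Rightarrow> 'a \<times> 'a set \<Rightarrow> 'a \<times> 'a set" where
  "flag_action \<phi> \<B> g = (\<lambda>(x, B) \<in> flags \<B>. (\<phi> g x, \<phi> g ` B))"

definition flag_transitive ::
  "('g, 'm) monoid_scheme \<Rightarrow> ('g \<Rightarrow> 'a \<Rightarrow> 'a) \<Rightarrow> 'a set set \<Rightarrow> bool" where
  "flag_transitive G \<phi> \<B> \<longleftrightarrow> transitive_action G (flags \<B>) (flag_action \<phi> \<B>)"

locale primitive_action = transitive_action +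
  assumes invariant_equiv_trivial:
    "\<lbrakk> equiv E R; \<And>g x y. \<lbrakk> g \<in> carrier G; (x, y) \<in> R \<rbrakk> \<Longrightarrow> (\<phi> g x, \<phi> g y) \<in> R \<rbrakk>
       \<Longrightarrow> R = Id_on E \<or> R = E \<times> E"

definition natural_action :: "'a set \<Rightarrow> ('a \<Rightarrow> 'a) \<Rightarrow> 'a \<Rightarrow> 'a" where
  "natural_action P g = restrict g P"

definition flag_transitive_point_primitive_designs ::
  "('g, 'm) monoid_scheme \<Rightarrow> 'a set \<Rightarrow> ('g \<Rightarrow> 'a \<Rightarrow> 'a) \<Rightarrow> 'a set set set" where
  "flag_transitive_point_primitive_designs G P \<phi> =
     {\<B>. (\<exists>v k lam. nontrivial_two_design P \<B> v k lam) \<and>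
          acts_as_automorphism_group G P \<phi> \<B> \<and>
          flag_transitive G \<phi> \<B> \<and> primitive_action G P \<phi>}"

end

theory Submission
  imports Defs
begin

text \<open>
  The alternating group is transitive on the flags of the full design of \<open>k\<close>-subsets whenever
  \<open>k \<le> n - 2\<close>: two points outside the target block can be swapped to correct the sign of a
  permutation. So the blocks of an invariant design form a single orbit containing all
  \<open>k\<close>-subsets. For \<open>k = 2\<close> the same statement is 2-transitivity, which gives primitivity.
\<close>

section \<open>Group actions from pointwise laws\<close>

lemma group_actionI:
  assumes "group G"
    and "\<And>g. g \<in> carrier G \<Longrightarrow> \<phi> g \<in> extensional E"
    and closed: "\<And>g x. g \<in> carrier G \<Longrightarrow> x \<in> E \<Longrightarrow> \<phi> g x \<in> E"
    and one: "\<And>x. x \<in> E \<Longrightarrow> \<phi> \<one>\<^bsub>G\<^esub> x = x"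
    and mult: "\<And>g h x. g \<in> carrier G \<Longrightarrow> h \<in> carrier G \<Longrightarrow> x \<in> E \<Longrightarrow>
                 \<phi> (g \<otimes>\<^bsub>G\<^esub> h) x = \<phi> g (\<phi> h x)"
  shows "group_action G E \<phi>"
proof -
  interpret group G by fact
  have Bij: "\<phi> g \<in> Bij E" if "g \<in> carrier G" for g
  proof -
    \<comment> \<open>The laws for the unit and for products make \<open>inv g\<close> act as a
      two-sided inverse of \<open>g\<close>, so bijectivity need not be assumed.\<close>
    have "bij_betw (\<phi> g) E E"
    proof (rule bij_betw_byWitness[where f' = "\<phi> (inv\<^bsub>G\<^esub> g)"])
      show "\<forall>x\<in>E. \<phi> (inv\<^bsub>G\<^esub> g) (\<phi> g x) = x"
        using that by (simp flip: mult) (simp add: one)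
      show "\<forall>x\<in>E. \<phi> g (\<phi> (inv\<^bsub>G\<^esub> g) x) = x"
        using that by (simp flip: mult) (simp add: one)
    qed (use that closed in auto)
    with assms(2) that show ?thesis by (simp add: Bij_def)
  qed
  have "\<phi> (g \<otimes>\<^bsub>G\<^esub> h) = compose E (\<phi> g) (\<phi> h)" if "g \<in> carrier G" "h \<in> carrier G" for g h
    using that assms(2) by (intro extensionalityI[where A = E]) (auto simp: mult compose_eq)
  then have "\<phi> \<in> hom G (BijGroup E)"
    by (auto simp: hom_def BijGroup_def Bij)
  then show ?thesis
    by (simp add: group_action_def group_hom_def group_hom_axioms_def group_BijGroup is_group)
qed

section \<open>Permutations carrying one flag to another\<close>

lemma permutation_mapping_flag:
  assumes "finite P" "x \<in> B" "B \<subseteq> P" "y \<in> C" "C \<subseteq> P" "card B = card C"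
  obtains p where "p permutes P" "p x = y" "p ` B = C"
proof -
  have fin: "finite B" "finite C" using assms finite_subset by blast+
  then obtain f where f: "bij_betw f (B - {x}) (C - {y})"
    using assms by (metis card_Diff_singleton finite_Diff finite_same_card_bij)
  have "card (P - B) = card (P - C)"
    using assms fin by (simp add: card_Diff_subset)
  then obtain g where g: "bij_betw g (P - B) (P - C)"
    using assms by (metis finite_Diff finite_same_card_bij)
  \<comment> \<open>Three bijections are glued: \<open>x\<close> to \<open>y\<close>, the rest of
    \<open>B\<close> to the rest of \<open>C\<close>, and the complement of \<open>B\<close> to that
    of \<open>C\<close>. Outside \<open>P\<close> the value is \<open>z\<close>, as
    \<open>permutes\<close> demands.\<close>
  define p where "p z = (if z = x then y else if z \<in> B then f z else if z \<in> P then g z else z)" for z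
  have "bij_betw p {x} {y}"
    by (simp add: p_def bij_betw_def)
  moreover have "bij_betw p (B - {x}) (C - {y})"
    using f by (rule bij_betw_cong[THEN iffD1, rotated]) (simp add: p_def)
  ultimately have "bij_betw p ({x} \<union> (B - {x})) ({y} \<union> (C - {y}))"
    by (rule bij_betw_combine) auto
  then have pB: "bij_betw p B C"
    using assms by (simp add: insert_absorb)
  moreover have "bij_betw p (P - B) (P - C)"
    using g by (rule bij_betw_cong[THEN iffD1, rotated]) (use assms in \<open>auto simp: p_def\<close>)
  ultimately have "bij_betw p (B \<union> (P - B)) (C \<union> (P - C))"
    by (rule bij_betw_combine) auto
  then have "bij_betw p P P"
    using assms by (simp add: Un_absorb1)
  then have "p permutes P"
    by (rule bij_imp_permutes) (use assms in \<open>auto simp: p_def\<close>)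
  moreover have "p x = y" by (simp add: p_def)
  moreover have "p ` B = C" using pB by (simp add: bij_betw_def)
  ultimately show thesis by (rule that)
qed

lemma even_permutation_mapping_flag:
  assumes "finite P" "x \<in> B" "B \<subseteq> P" "y \<in> C" "C \<subseteq> P" "card B = card C"
    and "card C + 2 \<le> card P"
  obtains p where "p permutes P" "evenperm p" "p x = y" "p ` B = C"
proof -
  obtain p where p: "p permutes P" "p x = y" "p ` B = C"
    using permutation_mapping_flag[OF assms(1-6)] .
  show thesis
  proof (cases "evenperm p")
    case True
    with p show thesis by (intro that)
  next
    case False
    have "card (P - C) \<ge> 2"
      using assms by (simp add: card_Diff_subset finite_subset)
    then obtain a b where ab: "a \<noteq> b" "a \<in> P - C" "b \<in> P - C"
      by (metis card_2_iff insert_subset obtain_subset_with_card_n)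
    let ?t = "transpose a b"
    \<comment> \<open>Since \<open>?t\<close> fixes \<open>C\<close> pointwise, composing with it
      keeps both \<open>p x = y\<close> and the image \<open>C\<close> while reversing the
      parity.\<close>
    have fix_C: "?t c = c" if "c \<in> C" for c
      using ab that by (auto intro: transpose_apply_other)
    show thesis
    proof (rule that)
      show "(?t \<circ> p) permutes P"
        using ab p by (auto intro: permutes_compose permutes_swap_id)
      have "permutation p" using p assms permutation_permutes by blast
      then show "evenperm (?t \<circ> p)"
        using False ab by (simp add: evenperm_comp permutation_swap_id evenperm_swap)
      show "(?t \<circ> p) x = y" using fix_C p assms by simp
      show "(?t \<circ> p) ` B = C"
        using fix_C p by (simp flip: image_image cong: image_cong)
    qed
  qed
qed

section \<open>Parameters of full designs\<close>

lemma card_supersets_of_card: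
  assumes "finite P" "S \<subseteq> P" "card S \<le> k"
  shows "card {B. B \<subseteq> P \<and> card B = k \<and> S \<subseteq> B} = (card P - card S) choose (k - card S)"
proof -
  have finS: "finite S" using assms finite_subset by blast
  \<comment> \<open>Removing \<open>S\<close> and adding it back are mutually inverse. Taking
    \<open>S\<close> to be one point or two points later yields \<open>r\<close> and
    \<open>lam\<close> of the full design.\<close>
  have "bij_betw (\<lambda>B. B - S) {B. B \<subseteq> P \<and> card B = k \<and> S \<subseteq> B}
          {T. T \<subseteq> P - S \<and> card T = k - card S}"
  proof (rule bij_betw_byWitness[where f' = "\<lambda>T. T \<union> S"])
    show "(\<lambda>T. T \<union> S) ` {T. T \<subseteq> P - S \<and> card T = k - card S}
            \<subseteq> {B. B \<subseteq> P \<and> card B = k \<and> S \<subseteq> B}"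
    proof clarsimp
      fix T assume T: "T \<subseteq> P - S" "card T = k - card S"
      moreover have "finite T" using T assms finite_subset by blast
      ultimately show "T \<subseteq> P \<and> S \<subseteq> P \<and> card (T \<union> S) = k"
        using assms finS by (subst card_Un_disjoint) auto
    qed
  qed (use finS in \<open>auto simp: card_Diff_subset\<close>)
  then have "card {B. B \<subseteq> P \<and> card B = k \<and> S \<subseteq> B} = card {T. T \<subseteq> P - S \<and> card T = k - card S}"
    by (rule bij_betw_same_card)
  also have "\<dots> = (card P - card S) choose (k - card S)"
    using assms finS by (simp add: n_subsets card_Diff_subset)
  finally show ?thesis .
qed

text \<open>All entries except \<open>k\<close> are cardinalities of concrete sets, given a point
  for \<open>r\<close> and a pair for \<open>lam\<close>. The entry \<open>k\<close> is read off a
  block, and one exists because \<open>lam > 0\<close>.\<close>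

lemma has_parameters_unique:
  assumes "has_parameters P \<B> p" "has_parameters P \<B> q" "card P \<ge> 2"
  shows "p = q"
proof -
  obtain v b r k l where p: "p = (v, b, r, k, l)" by (cases p)
  obtain v' b' r' k' l' where q: "q = (v', b', r', k', l')" by (cases q)
  obtain x y where xy: "x \<in> P" "y \<in> P" "x \<noteq> y"
    using \<open>card P \<ge> 2\<close> by (metis card_2_iff insert_subset obtain_subset_with_card_n)
  have l: "card {B \<in> \<B>. x \<in> B \<and> y \<in> B} = l" "card {B \<in> \<B>. x \<in> B \<and> y \<in> B} = l'" "l > 0"
    using assms xy by (auto simp: p q has_parameters_def two_design_def)
  then obtain B where "B \<in> \<B>"
    by (metis (no_types, lifting) card.empty ex_in_conv less_irrefl mem_Collect_eq)
  then have "k = k'"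
    using assms by (auto simp: p q has_parameters_def two_design_def)
  moreover have "v = v'" "b = b'" "r = r'"
    using assms xy by (auto simp: p q has_parameters_def two_design_def)
  ultimately show ?thesis using l by (simp add: p q)
qed

lemma full_design_parameters:
  assumes "finite P" "2 \<le> k" "k \<le> card P"
  shows "has_parameters P {B. B \<subseteq> P \<and> card B = k}
           (card P, card P choose k, (card P - 1) choose (k - 1), k, (card P - 2) choose (k - 2))"
proof -
  have "card {B. (B \<subseteq> P \<and> card B = k) \<and> x \<in> B} = (card P - 1) choose (k - 1)" if "x \<in> P" for x
    using card_supersets_of_card[of P "{x}" k] that assms by (simp add: conj_assoc)
  moreover have "card {B. (B \<subseteq> P \<and> card B = k) \<and> x \<in> B \<and> y \<in> B} = (card P - 2) choose (k - 2)"
    if "x \<in> P" "y \<in> P" "x \<noteq> y" for x y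
    using card_supersets_of_card[of P "{x, y}" k] that assms
    by (simp add: conj_assoc flip: numeral_2_eq_2)
  \<comment> \<open>The clause \<open>lam > 0\<close> holds because \<open>k \<le> card P\<close>
    makes the last binomial coefficient nonzero.\<close>
  ultimately show ?thesis
    using assms by (simp add: has_parameters_def two_design_def n_subsets)
qed

section \<open>The natural action of a group containing all even permutations\<close>

lemma natural_action_apply [simp]: "x \<in> P \<Longrightarrow> natural_action P g x = g x"
  by (simp add: natural_action_def)

lemma natural_action_image [simp]: "B \<subseteq> P \<Longrightarrow> natural_action P g ` B = g ` B"
  by (auto simp: natural_action_def)

text \<open>One set of assumptions that serves the symmetric and the alternating group alike:
  permutations of \<open>P\<close> under composition, with all even ones present.\<close>

locale perm_group_over_alt = group G for G :: "('a \<Rightarrow> 'a) monoid" (structure) +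
  fixes P :: "'a set"
  assumes finite_P: "finite P"
    and mult_eq: "g \<otimes> h = g \<circ> h"
    and one_eq: "\<one> = id"
    and permutes: "g \<in> carrier G \<Longrightarrow> g permutes P"
    and even_in_carrier: "\<lbrakk> p permutes P; evenperm p \<rbrakk> \<Longrightarrow> p \<in> carrier G"
begin

text \<open>Applied to singletons this is transitivity on points, to pairs it is 2-transitivity, and
  to \<open>k\<close>-subsets it is transitivity on the flags of the full design.\<close>

lemma element_mapping_flag:
  assumes "x \<in> B" "B \<subseteq> P" "y \<in> C" "C \<subseteq> P" "card B = card C" "card C + 2 \<le> card P"
  obtains g where "g \<in> carrier G" "g x = y" "g ` B = C"
  using even_permutation_mapping_flag[OF finite_P assms] even_in_carrier by metis

lemma group_action_natural: "group_action G P (natural_action P)"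
proof (rule group_actionI)
  show "natural_action P g x \<in> P" if "g \<in> carrier G" "x \<in> P" for g x
    using that permutes[of g] by (simp add: permutes_in_image)
  show "natural_action P (g \<otimes> h) x = natural_action P g (natural_action P h x)"
    if "g \<in> carrier G" "h \<in> carrier G" "x \<in> P" for g h x
    using that permutes[of h] by (simp add: mult_eq permutes_in_image)
qed (auto simp: is_group one_eq natural_action_def)

text \<open>Restricting to \<open>P\<close> loses no information, because every element of the group
  fixes all points outside \<open>P\<close>.\<close>

lemma faithful_natural: "faithful_action G P (natural_action P)"
proof -
  have "g = h" if gh: "g \<in> carrier G" "h \<in> carrier G" "natural_action P g = natural_action P h" for g h
  proof
    fix x show "g x = h x"
    proof (cases "x \<in> P")
      case True
      then show ?thesis using fun_cong[OF gh(3), of x] by simp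
    next
      case False
      then show ?thesis using gh permutes permutes_not_in by metis
    qed
  qed
  then show ?thesis
    by (simp add: faithful_action_def faithful_action_axioms_def group_action_natural inj_on_def)
qed

lemma primitive_natural:
  assumes "card P \<ge> 4"
  shows "primitive_action G P (natural_action P)"
proof -
  have "\<exists>g\<in>carrier G. natural_action P g x = y" if "x \<in> P" "y \<in> P" for x y
    using element_mapping_flag[of x "{x}" y "{y}"] that assms by auto
  then have trans: "transitive_action G P (natural_action P)"
    by (simp add: transitive_action_def transitive_action_axioms_def group_action_natural)
  have "R = Id_on P \<or> R = P \<times> P"
    if R: "equiv P R"
      and inv: "\<And>g x y. \<lbrakk> g \<in> carrier G; (x, y) \<in> R \<rbrakk>
                  \<Longrightarrow> (natural_action P g x, natural_action P g y) \<in> R" for R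
  proof -
    have refl: "(x, x) \<in> R" if "x \<in> P" for x
      using R that by (auto simp: equiv_def refl_on_def)
    have sub: "R \<subseteq> P \<times> P" using R equiv_type by blast
    show ?thesis
    proof (cases "R \<subseteq> Id")
      case True
      with sub refl show ?thesis by (auto simp: Id_on_def)
    next
      case False
      then obtain a b where ab: "(a, b) \<in> R" "a \<noteq> b" by auto
      then have abP: "a \<in> P" "b \<in> P" using sub by auto
      have "(c, d) \<in> R" if cd: "c \<in> P" "d \<in> P" "c \<noteq> d" for c d
      proof -
        \<comment> \<open>Treating the pair as a block needs two further points outside
          \<open>{c, d}\<close>, supplied by \<open>card P \<ge> 4\<close>. As \<open>a\<close> goes
          to \<open>c\<close>, the other point \<open>b\<close> must go to \<open>d\<close>, so a
          single nontrivial pair forces all pairs into \<open>R\<close>.\<close>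
        obtain g where g: "g \<in> carrier G" "g a = c" "g ` {a, b} = {c, d}"
          using element_mapping_flag[of a "{a, b}" c "{c, d}"] cd ab abP assms by auto
        then have "g b = d" using cd by (auto simp: doubleton_eq_iff)
        then show ?thesis using inv[OF g(1) ab(1)] g abP by simp
      qed
      with refl sub show ?thesis by auto
    qed
  qed
  then show ?thesis
    using trans by (simp add: primitive_action_def primitive_action_axioms_def)
qed

lemma flag_transitive_full:
  assumes "k + 2 \<le> card P"
  shows "flag_transitive G (natural_action P) {B. B \<subseteq> P \<and> card B = k}" (is "flag_transitive _ _ ?\<B>")
proof -
  have closed: "g ` B \<in> ?\<B>" if "g \<in> carrier G" "B \<in> ?\<B>" for g B
    using that permutes[of g]
    by (auto simp: permutes_in_image card_image[OF inj_on_subset[OF permutes_inj]])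
  \<comment> \<open>On a flag the restrictions in \<open>flag_action\<close> and
    \<open>natural_action\<close> both disappear. Together with \<open>flags_closed\<close> this
    lets composed actions be evaluated.\<close>
  have flag_apply: "flag_action (natural_action P) ?\<B> g (x, B) = (g x, g ` B)"
    if "(x, B) \<in> flags ?\<B>" for g x B
    using that by (auto simp: flag_action_def flags_def)
  have flags_closed: "(g x, g ` B) \<in> flags ?\<B>" if "g \<in> carrier G" "(x, B) \<in> flags ?\<B>" for g x B
    using that closed[of g B] by (auto simp: flags_def)
  have "group_action G (flags ?\<B>) (flag_action (natural_action P) ?\<B>)"
  proof (rule group_actionI)
    show "flag_action (natural_action P) ?\<B> g \<in> extensional (flags ?\<B>)" for g
      by (simp add: flag_action_def)
  qed (auto simp: is_group one_eq mult_eq flag_apply flags_closed image_comp)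
  moreover have "\<exists>g\<in>carrier G. flag_action (natural_action P) ?\<B> g f = f'"
    if ff: "f \<in> flags ?\<B>" "f' \<in> flags ?\<B>" for f f'
  proof -
    obtain x B y C where eq: "f = (x, B)" "f' = (y, C)" by (cases f, cases f')
    then obtain g where "g \<in> carrier G" "g x = y" "g ` B = C"
      using ff assms element_mapping_flag[of x B y C] by (auto simp: flags_def)
    then show ?thesis using ff eq by (auto simp: flag_apply)
  qed
  ultimately show ?thesis
    by (simp add: flag_transitive_def transitive_action_def transitive_action_axioms_def)
qed

lemma automorphism_group_full:
  "acts_as_automorphism_group G P (natural_action P) {B. B \<subseteq> P \<and> card B = k}"
proof -
  have "natural_action P g ` B \<subseteq> P" "card (natural_action P g ` B) = card B"
    if "g \<in> carrier G" "B \<subseteq> P" for g B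
    using that permutes[of g]
    by (auto simp: permutes_in_image card_image[OF inj_on_subset[OF permutes_inj]])
  then show ?thesis
    using faithful_natural group_action.bij_prop0[OF group_action_natural]
    by (simp add: acts_as_automorphism_group_def design_automorphism_def)
qed

lemma invariant_two_design_full:
  assumes design: "two_design P \<B> v k lam" and "0 < k" "k + 2 \<le> v"
    and aut: "acts_as_automorphism_group G P (natural_action P) \<B>"
  shows "full_design P \<B> k"
proof -
  have v: "card P = v" and blocks: "\<And>B. B \<in> \<B> \<Longrightarrow> B \<subseteq> P \<and> card B = k"
    using design by (auto simp: two_design_def)
  have "2 \<le> card P" using v assms by linarith
  then obtain x y where "x \<in> P" "y \<in> P" "x \<noteq> y"
    using \<open>2 \<le> card P\<close> by (metis card_2_iff insert_subset obtain_subset_with_card_n)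
  \<comment> \<open>Positivity of \<open>lam\<close> provides a block from which the orbit can
    start.\<close>
  then have "card {B \<in> \<B>. x \<in> B \<and> y \<in> B} > 0"
    using design by (simp add: two_design_def)
  then obtain B where B: "B \<in> \<B>"
    by (metis (no_types, lifting) card.empty ex_in_conv less_irrefl mem_Collect_eq)
  have "C \<in> \<B>" if C: "C \<subseteq> P" "card C = k" for C
  proof -
    \<comment> \<open>Points are chosen to turn \<open>B\<close> and \<open>C\<close> into flags;
      \<open>0 < k\<close> makes both sets nonempty.\<close>
    obtain z w where "z \<in> B" "w \<in> C"
      using C blocks[OF B] \<open>0 < k\<close> by (metis card.empty ex_in_conv less_irrefl)
    moreover have "B \<subseteq> P" "card B = card C" "card C + 2 \<le> card P"
      using C blocks[OF B] v assms(3) by auto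
    ultimately obtain g where g: "g \<in> carrier G" "g ` B = C"
      using C(1) element_mapping_flag by metis
    have "natural_action P g ` B \<in> \<B>"
      using aut g B by (simp add: acts_as_automorphism_group_def design_automorphism_def)
    with g blocks[OF B] show ?thesis by simp
  qed
  with blocks show ?thesis by (auto simp: full_design_def)
qed

lemma designs_eq_full:
  assumes "card P \<ge> 4"
  shows "flag_transitive_point_primitive_designs G P (natural_action P) =
           (\<lambda>k. {B. B \<subseteq> P \<and> card B = k}) ` {3..card P - 2}"
proof (intro subset_antisym subsetI)
  fix \<B> assume "\<B> \<in> flag_transitive_point_primitive_designs G P (natural_action P)"
  then obtain v k lam where design: "two_design P \<B> v k lam" and k: "2 < k" "k < v - 1"
    and aut: "acts_as_automorphism_group G P (natural_action P) \<B>"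
    by (auto simp: flag_transitive_point_primitive_designs_def nontrivial_two_design_def)
  \<comment> \<open>The bound \<open>k < v - 1\<close> amounts to \<open>k + 2 \<le> v\<close>,
    which is the room needed for a swap outside a block.\<close>
  have "full_design P \<B> k"
    using k by (intro invariant_two_design_full[OF design _ _ aut]) auto
  moreover have "v = card P" using design by (simp add: two_design_def)
  ultimately show "\<B> \<in> (\<lambda>k. {B. B \<subseteq> P \<and> card B = k}) ` {3..card P - 2}"
    using k by (auto simp: full_design_def)
next
  fix \<B> assume "\<B> \<in> (\<lambda>k. {B. B \<subseteq> P \<and> card B = k}) ` {3..card P - 2}"
  then obtain k where \<B>: "\<B> = {B. B \<subseteq> P \<and> card B = k}" and k: "3 \<le> k" "k \<le> card P - 2"
    by auto
  have "two_design P \<B> (card P) k ((card P - 2) choose (k - 2))"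
    using full_design_parameters[of P k] k finite_P by (simp add: has_parameters_def \<B>)
  then have "nontrivial_two_design P \<B> (card P) k ((card P - 2) choose (k - 2))"
    using k by (simp add: nontrivial_two_design_def)
  moreover have "flag_transitive G (natural_action P) \<B>"
    unfolding \<B> by (rule flag_transitive_full) (use k in simp)
  ultimately show "\<B> \<in> flag_transitive_point_primitive_designs G P (natural_action P)"
    using primitive_natural[OF assms] automorphism_group_full[of k]
    by (auto simp: flag_transitive_point_primitive_designs_def \<B>)
qed

end

section \<open>The symmetric and alternating groups, and the count of designs\<close>

lemma perm_group_over_alt_sym_or_alt:
  assumes "G = sym_group n \<or> G = alt_group n"
  shows "perm_group_over_alt G {1..n}"
proof -
  have "group G"
    using assms sym_group_is_group alt_group_is_group by auto
  then show ?thesis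
    using assms
    by (auto simp: perm_group_over_alt_def perm_group_over_alt_axioms_def sym_group_carrier
        alt_group_carrier sym_group_mult alt_group_mult sym_group_one alt_group_one)
qed

text \<open>Any member of the family reveals \<open>k\<close>. The bound \<open>card P\<close>
  matters, since all families beyond it are empty. Injectivity turns counting designs into counting
  block sizes.\<close>

lemma inj_on_full_blocks:
  assumes "finite P"
  shows "inj_on (\<lambda>k. {B. B \<subseteq> P \<and> card B = k}) {..card P}"
proof (rule inj_onI)
  fix k l
  assume "k \<in> {..card P}" and eq: "{B. B \<subseteq> P \<and> card B = k} = {B. B \<subseteq> P \<and> card B = l}"
  then obtain B where "B \<subseteq> P" "card B = k"
    by (meson atMost_iff obtain_subset_with_card_n)
  with eq show "k = l" by auto
qed

theorem theorem1:
  fixes n :: nat and G :: "(nat \<Rightarrow> nat) monoid" and P :: "nat set"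
    and designs :: "nat set set set"
  assumes "n \<ge> 5"
    and "G = sym_group n \<or> G = alt_group n"
    and "P = {1..n}"
    and "designs = flag_transitive_point_primitive_designs G P (natural_action P)"
  shows "card designs = n - 4 \<and>
    (\<forall>\<B>\<in>designs. \<forall>v k lam. two_design P \<B> v k lam \<longrightarrow> full_design P \<B> k) \<and>
    {p. \<exists>\<B>\<in>designs. has_parameters P \<B> p} =
      {(n, n choose k, (n - 1) choose (k - 1), k, (n - 2) choose (k - 2)) | k. k \<in> {3..n - 2}}"
proof -
  interpret perm_group_over_alt G P
    using perm_group_over_alt_sym_or_alt assms by blast
  let ?full = "\<lambda>k. {B. B \<subseteq> P \<and> card B = k}"
  let ?par = "\<lambda>k. (n, n choose k, (n - 1) choose (k - 1), k, (n - 2) choose (k - 2))"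
  have cardP: "card P = n" using assms by simp
  have designs: "designs = ?full ` {3..n - 2}"
    using designs_eq_full assms cardP by simp
  have params: "has_parameters P (?full k) (?par k)" if "k \<in> {3..n - 2}" for k
    using full_design_parameters[OF finite_P, of k] that by (auto simp: cardP)
  \<comment> \<open>Uniqueness excludes any further tuple for the same design, so the set of
    parameter tuples equals the listed one instead of merely containing it.\<close>
  have params_iff: "has_parameters P (?full k) p \<longleftrightarrow> p = ?par k" if "k \<in> {3..n - 2}" for k p
  proof -
    have "card P \<ge> 2" using assms(1) cardP by simp
    then show ?thesis using has_parameters_unique params[OF that] by blast
  qed
  have "inj_on ?full {3..n - 2}"
    using inj_on_full_blocks[OF finite_P] by (rule inj_on_subset) (auto simp: cardP)
  \<comment> \<open>The interval \<open>{3..n - 2}\<close> has \<open>(n - 2) - 3 + 1\<close>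
    elements, one design for each.\<close>
  then have "card designs = n - 4"
    using assms(1) by (simp add: designs card_image)
  moreover have "full_design P \<B> k" if \<B>: "\<B> \<in> designs" "two_design P \<B> v k lam" for \<B> v k lam
  proof -
    obtain l where l: "\<B> = ?full l" "l \<le> n - 2"
      using \<B>(1) by (auto simp: designs)
    then have "l \<le> card P" using cardP by simp
    \<comment> \<open>The given \<open>k\<close> could differ from \<open>l\<close> only if the
      family had no block; a block of size \<open>l\<close> rules this out.\<close>
    then obtain B where "B \<subseteq> P" "card B = l" by (rule obtain_subset_with_card_n)
    then have "k = l" using \<B>(2) l(1) by (auto simp: two_design_def)
    then show ?thesis using l by (simp add: full_design_def)
  qed
  moreover have "{p. \<exists>\<B>\<in>designs. has_parameters P \<B> p} = {?par k | k. k \<in> {3..n - 2}}"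
    by (auto simp: designs params_iff)
  ultimately show ?thesis by blast
qed

end
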